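(* Let $\phi\bullet\psi$ be a product or skew-product dynamical system on $X\times Y$ with base system $\psi$ on $Y$, where $X,Y$ are compact metric spaces, and let $\pi_Y\colon X\times Y\to Y$ be the projection. The map $\mathsf{ANbhd}(\phi\bullet\psi)\to\mathsf{ANbhd}(\psi)$, $N\mapsto\pi_Y(N)$, is a join-semilattice homomorphism. Moreover, the induced map $\mathsf{Att}(\phi\bullet\psi)\to\mathsf{Att}(\psi)$, $A\mapsto\pi_Y(A)$, is also a join-semilattice homomorphism.
   Context: $\mathbb{T}$ is $\mathbb{Z}$ or $\mathbb{R}$, $\mathbb{T}^+$ its nonnegative part. A dynamical system on a compact metric space $Z$ is a continuous map $\theta\colon\mathbb{T}^+\times Z\to Z$ with $\theta(0,z)=z$, $\theta(t,\theta(s,z))=\theta(t+s,z)$ (not assumed injective or surjective). Product system: for dynamical systems $\phi$ on $X$ and $\psi$ on $Y$, $(\phi\times\psi)(t,(x,y))=(\phi(t,x),\psi(t,y))$. Skew-product system: $(\phi\rtimes\psi)(t,(x,y))=(\phi(t,x,y),\psi(t,y))$ where $\psi$ is a dynamical system on $Y$ and $\phi\colon\mathbb{T}^+\times X\times Y\to X$ is continuous with $\phi(0,x,y)=x$ and $\phi(t+s,x,y)=\phi(t,\phi(s,x,y),\psi(s,y))$. $\phi\bullet\psi$ denotes either. $\omega(U)=\bigcap_{t\ge0}\mathrm{cl}(\theta([t,\infty),U))$. $U\subset Z$ is an attracting neighborhood if there is $\tau>0$ with $\theta(t,\mathrm{cl}(U))\subset\mathrm{int}(U)$ for all $t\ge\tau$;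 an attractor is $\omega(U)$ for an attracting neighborhood $U$. $\mathsf{ANbhd}(\theta)$ is the lattice of attracting neighborhoods with $\vee=\cup$, $\wedge=\cap$; $\mathsf{Att}(\theta)$ is the lattice of attractors with $\vee=\cup$, $A\wedge B=\omega(A\cap B)$. *)

theory Defs
  imports "HOL-Analysis.Analysis"
begin

text \<open>The time group is a subset of the reals, either the integers or all reals, so that
  discrete and continuous time are treated at once. A compact metric space is a compact subset
  of a type of class \<^class>\<open>metric_space\<close>; it is the whole phase space, so closure and
  interior are taken relative to it. Maps are only constrained for nonnegative times and on
  the phase space.\<close>

definition nonneg_time :: "real set \<Rightarrow> real set" where
  "nonneg_time T = {t \<in> T. 0 \<le> t}"

definition dynamical_system ::
  "real set \<Rightarrow> 'z::metric_space set \<Rightarrow> (real \<Rightarrow> 'z \<Rightarrow> 'z) \<Rightarrow> bool" where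
  "dynamical_system T Z \<theta> \<longleftrightarrow>
     (T = \<int> \<or> T = UNIV) \<and> compact Z \<and>
     (\<forall>t\<in>nonneg_time T. \<forall>z\<in>Z. \<theta> t z \<in> Z) \<and>
     continuous_on (nonneg_time T \<times> Z) (\<lambda>(t, z). \<theta> t z) \<and>
     (\<forall>z\<in>Z. \<theta> 0 z = z) \<and>
     (\<forall>t\<in>nonneg_time T. \<forall>s\<in>nonneg_time T. \<forall>z\<in>Z. \<theta> t (\<theta> s z) = \<theta> (t + s) z)"

definition product_map ::
  "(real \<Rightarrow> 'x \<Rightarrow> 'x) \<Rightarrow> (real \<Rightarrow> 'y \<Rightarrow> 'y) \<Rightarrow> real \<Rightarrow> 'x \<times> 'y \<Rightarrow> 'x \<times> 'y" where
  "product_map \<phi> \<psi> = (\<lambda>t (x, y). (\<phi> t x, \<psi> t y))"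

definition skew_product_map ::
  "(real \<Rightarrow> 'x \<Rightarrow> 'y \<Rightarrow> 'x) \<Rightarrow> (real \<Rightarrow> 'y \<Rightarrow> 'y) \<Rightarrow> real \<Rightarrow> 'x \<times> 'y \<Rightarrow> 'x \<times> 'y" where
  "skew_product_map \<phi> \<psi> = (\<lambda>t (x, y). (\<phi> t x y, \<psi> t y))"

definition product_system ::
  "real set \<Rightarrow> 'x::metric_space set \<Rightarrow> 'y::metric_space set \<Rightarrow>
   (real \<Rightarrow> 'y \<Rightarrow> 'y) \<Rightarrow> (real \<Rightarrow> 'x \<times> 'y \<Rightarrow> 'x \<times> 'y) \<Rightarrow> bool" where
  "product_system T X Y \<psi> \<Theta> \<longleftrightarrow>
     (\<exists>\<phi>. dynamical_system T X \<phi> \<and> dynamical_system T Y \<psi> \<and> \<Theta> = product_map \<phi> \<psi>)"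

definition fibre_cocycle ::
  "real set \<Rightarrow> 'x::metric_space set \<Rightarrow> 'y::metric_space set \<Rightarrow>
   (real \<Rightarrow> 'x \<Rightarrow> 'y \<Rightarrow> 'x) \<Rightarrow> (real \<Rightarrow> 'y \<Rightarrow> 'y) \<Rightarrow> bool" where
  "fibre_cocycle T X Y \<phi> \<psi> \<longleftrightarrow>
     (\<forall>t\<in>nonneg_time T. \<forall>x\<in>X. \<forall>y\<in>Y. \<phi> t x y \<in> X) \<and>
     continuous_on (nonneg_time T \<times> X \<times> Y) (\<lambda>(t, x, y). \<phi> t x y) \<and>
     (\<forall>x\<in>X. \<forall>y\<in>Y. \<phi> 0 x y = x) \<and>
     (\<forall>t\<in>nonneg_time T. \<forall>s\<in>nonneg_time T. \<forall>x\<in>X. \<forall>y\<in>Y.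
        \<phi> (t + s) x y = \<phi> t (\<phi> s x y) (\<psi> s y))"

definition skew_product_system ::
  "real set \<Rightarrow> 'x::metric_space set \<Rightarrow> 'y::metric_space set \<Rightarrow>
   (real \<Rightarrow> 'y \<Rightarrow> 'y) \<Rightarrow> (real \<Rightarrow> 'x \<times> 'y \<Rightarrow> 'x \<times> 'y) \<Rightarrow> bool" where
  "skew_product_system T X Y \<psi> \<Theta> \<longleftrightarrow> compact X \<and> dynamical_system T Y \<psi> \<and>
     (\<exists>\<phi>. fibre_cocycle T X Y \<phi> \<psi> \<and> \<Theta> = skew_product_map \<phi> \<psi>)"

definition omega_limit ::
  "real set \<Rightarrow> 'z::metric_space set \<Rightarrow> (real \<Rightarrow> 'z \<Rightarrow> 'z) \<Rightarrow> 'z set \<Rightarrow> 'z set" where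
  "omega_limit T Z \<theta> U =
     (\<Inter>t\<in>nonneg_time T. top_of_set Z closure_of {\<theta> s z |s z. s \<in> T \<and> t \<le> s \<and> z \<in> U})"

definition attracting_nbhd ::
  "real set \<Rightarrow> 'z::metric_space set \<Rightarrow> (real \<Rightarrow> 'z \<Rightarrow> 'z) \<Rightarrow> 'z set \<Rightarrow> bool" where
  "attracting_nbhd T Z \<theta> U \<longleftrightarrow> U \<subseteq> Z \<and>
     (\<exists>\<tau>\<in>T. 0 < \<tau> \<and> (\<forall>t\<in>T. \<tau> \<le> t \<longrightarrow>
        \<theta> t ` (top_of_set Z closure_of U) \<subseteq> top_of_set Z interior_of U))"

definition ANbhd :: "real set \<Rightarrow> 'z::metric_space set \<Rightarrow> (real \<Rightarrow> 'z \<Rightarrow> 'z) \<Rightarrow> 'z set set" where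
  "ANbhd T Z \<theta> = {U. attracting_nbhd T Z \<theta> U}"

definition Att :: "real set \<Rightarrow> 'z::metric_space set \<Rightarrow> (real \<Rightarrow> 'z \<Rightarrow> 'z) \<Rightarrow> 'z set set" where
  "Att T Z \<theta> = omega_limit T Z \<theta> ` ANbhd T Z \<theta>"

definition join_semilattice :: "'a set \<Rightarrow> ('a \<Rightarrow> 'a \<Rightarrow> 'a) \<Rightarrow> bool" where
  "join_semilattice L j \<longleftrightarrow>
     (\<forall>a\<in>L. \<forall>b\<in>L. j a b \<in> L) \<and>
     (\<forall>a\<in>L. \<forall>b\<in>L. \<forall>c\<in>L. j (j a b) c = j a (j b c)) \<and>
     (\<forall>a\<in>L. \<forall>b\<in>L. j a b = j b a) \<and>
     (\<forall>a\<in>L. j a a = a)"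

definition join_semilattice_hom ::
  "'a set \<Rightarrow> ('a \<Rightarrow> 'a \<Rightarrow> 'a) \<Rightarrow> 'b set \<Rightarrow> ('b \<Rightarrow> 'b \<Rightarrow> 'b) \<Rightarrow> ('a \<Rightarrow> 'b) \<Rightarrow> bool" where
  "join_semilattice_hom L j M k f \<longleftrightarrow>
     join_semilattice L j \<and> join_semilattice M k \<and>
     (\<forall>a\<in>L. f a \<in> M) \<and> (\<forall>a\<in>L. \<forall>b\<in>L. f (j a b) = k (f a) (f b))"

end

theory Submission
  imports Defs
begin

text \<open>The projection \<^term>\<open>snd\<close> intertwines the (skew-)product with its base, so the result is
  about a semiconjugacy between compact spaces; the only further property of the projection
  that matters is that it is an open map.

  Continuity and compactness make the factor map closed, so it commutes with closure;
  openness makes it carry interiors into interiors. Together these push the defining inclusion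
  ``\<open>\<theta>\<^sub>t\<close> maps the closure of \<open>N\<close> into the interior of \<open>N\<close>'' down to the image of \<open>N\<close>
  (lemma \<open>attracting_nbhd_image\<close>).

  An omega-limit set is the intersection of the decreasing family of closures of the orbit
  tails. The factor map sends tails to tails and closures to closures, and by the finite
  intersection property, applied in a fibre, it also commutes with decreasing intersections of
  closed sets. Hence it commutes with the formation of omega-limit sets (lemma
  \<open>omega_limit_image\<close>), and so it sends attractors to attractors.

  Images always commute with unions. What remains is that unions are joins on both sides, which
  for attractors is the identity \<open>\<omega>(U \<union> V) = \<omega>(U) \<union> \<omega>(V)\<close>; the nontrivial inclusion holds
  because a point missed by some tail closure of \<open>U\<close> and by some tail closure of \<open>V\<close> is missed
  by both at the later of the two times.\<close>

section \<open>Orbit tails and omega-limit sets\<close>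

definition orbit_tail ::
  "real set \<Rightarrow> (real \<Rightarrow> 'z \<Rightarrow> 'z) \<Rightarrow> real \<Rightarrow> 'z set \<Rightarrow> 'z set" where
  "orbit_tail T \<theta> t U = {\<theta> s z |s z. s \<in> T \<and> t \<le> s \<and> z \<in> U}"

lemma omega_limit_eq_INT_orbit_tail:
  "omega_limit T Z \<theta> U = (\<Inter>t\<in>nonneg_time T. top_of_set Z closure_of orbit_tail T \<theta> t U)"
  by (simp add: omega_limit_def orbit_tail_def)

lemma orbit_tail_antimono: "s \<le> t \<Longrightarrow> orbit_tail T \<theta> t U \<subseteq> orbit_tail T \<theta> s U"
  unfolding orbit_tail_def by fastforce

lemma orbit_tail_Un: "orbit_tail T \<theta> t (U \<union> V) = orbit_tail T \<theta> t U \<union> orbit_tail T \<theta> t V"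
  unfolding orbit_tail_def by blast

lemma max_in_nonneg_time:
  "s \<in> nonneg_time T \<Longrightarrow> t \<in> nonneg_time T \<Longrightarrow> max s t \<in> nonneg_time T"
  by (simp add: max_def)

lemma omega_limit_Un:
  "omega_limit T Z \<theta> (U \<union> V) = omega_limit T Z \<theta> U \<union> omega_limit T Z \<theta> V"
proof
  let ?K = "\<lambda>W t. top_of_set Z closure_of orbit_tail T \<theta> t W"
  have antimono: "?K W t \<subseteq> ?K W s" if "s \<le> t" for W s t
    using that by (intro closure_of_mono orbit_tail_antimono)
  show "omega_limit T Z \<theta> (U \<union> V) \<subseteq> omega_limit T Z \<theta> U \<union> omega_limit T Z \<theta> V"
  proof (rule subsetI, rule ccontr)
    fix z
    assume z: "z \<in> omega_limit T Z \<theta> (U \<union> V)"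
      and "z \<notin> omega_limit T Z \<theta> U \<union> omega_limit T Z \<theta> V"
    then obtain s t where "s \<in> nonneg_time T" "z \<notin> ?K U s" "t \<in> nonneg_time T" "z \<notin> ?K V t"
      unfolding omega_limit_eq_INT_orbit_tail by blast
    moreover from this have "z \<in> ?K (U \<union> V) (max s t)"
      using z max_in_nonneg_time unfolding omega_limit_eq_INT_orbit_tail by blast
    ultimately show False
      using antimono[of s "max s t" U] antimono[of t "max s t" V] by (auto simp: orbit_tail_Un)
  qed
qed (auto simp: omega_limit_eq_INT_orbit_tail orbit_tail_Un)

section \<open>The semilattices of attracting neighbourhoods and of attractors\<close>

lemma attracting_nbhd_Un:
  assumes "attracting_nbhd T Z \<theta> U" "attracting_nbhd T Z \<theta> V"
  shows "attracting_nbhd T Z \<theta> (U \<union> V)"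
proof -
  let ?cl = "\<lambda>W. top_of_set Z closure_of W" and ?int = "\<lambda>W. top_of_set Z interior_of W"
  obtain \<sigma> where \<sigma>: "\<sigma> \<in> T" "0 < \<sigma>" "\<And>t. t \<in> T \<Longrightarrow> \<sigma> \<le> t \<Longrightarrow> \<theta> t ` ?cl U \<subseteq> ?int U"
    using assms(1) unfolding attracting_nbhd_def by blast
  obtain \<tau> where \<tau>: "\<tau> \<in> T" "0 < \<tau>" "\<And>t. t \<in> T \<Longrightarrow> \<tau> \<le> t \<Longrightarrow> \<theta> t ` ?cl V \<subseteq> ?int V"
    using assms(2) unfolding attracting_nbhd_def by blast
  have "?int U \<union> ?int V \<subseteq> ?int (U \<union> V)"
    by (simp add: interior_of_mono)
  then have "\<theta> t ` ?cl (U \<union> V) \<subseteq> ?int (U \<union> V)" if "t \<in> T" "max \<sigma> \<tau> \<le> t" for t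
    using \<sigma>(3)[of t] \<tau>(3)[of t] that by (simp add: image_Un) blast
  moreover have "max \<sigma> \<tau> \<in> T" "0 < max \<sigma> \<tau>"
    using \<sigma> \<tau> by (auto simp: max_def)
  moreover have "U \<union> V \<subseteq> Z"
    using assms by (simp add: attracting_nbhd_def)
  ultimately show ?thesis
    unfolding attracting_nbhd_def by (intro conjI bexI[of _ "max \<sigma> \<tau>"]) simp_all
qed

lemma join_semilattice_Un:
  "(\<And>a b. a \<in> L \<Longrightarrow> b \<in> L \<Longrightarrow> a \<union> b \<in> L) \<Longrightarrow> join_semilattice L (\<union>)"
  unfolding join_semilattice_def by (simp add: Un_ac)

lemma join_semilattice_ANbhd: "join_semilattice (ANbhd T Z \<theta>) (\<union>)"
  by (rule join_semilattice_Un) (simp add: ANbhd_def attracting_nbhd_Un)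

lemma join_semilattice_Att: "join_semilattice (Att T Z \<theta>) (\<union>)"
proof (rule join_semilattice_Un)
  fix A B
  assume "A \<in> Att T Z \<theta>" "B \<in> Att T Z \<theta>"
  then obtain U V where UV: "attracting_nbhd T Z \<theta> U" "attracting_nbhd T Z \<theta> V"
    and "A = omega_limit T Z \<theta> U" "B = omega_limit T Z \<theta> V"
    unfolding Att_def ANbhd_def by blast
  then have "A \<union> B = omega_limit T Z \<theta> (U \<union> V)"
    by (simp add: omega_limit_Un)
  then show "A \<union> B \<in> Att T Z \<theta>"
    unfolding Att_def ANbhd_def using attracting_nbhd_Un[OF UV] by blast
qed

section \<open>Images under closed maps\<close>

lemma closed_map_image_closure_of:
  assumes "continuous_map X Y f" "closed_map X Y f" "S \<subseteq> topspace X"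
  shows "f ` (X closure_of S) = Y closure_of (f ` S)"
proof
  show "f ` (X closure_of S) \<subseteq> Y closure_of (f ` S)"
    using assms(1) by (rule continuous_map_image_closure_subset)
  show "Y closure_of (f ` S) \<subseteq> f ` (X closure_of S)"
    using assms(2,3) by (metis closed_map_closure_of_image)
qed

text \<open>A point of all the images has a fibre that meets every member of the family; compactness
  of the ambient space then makes the fibre meet the intersection. Points being closed in the
  target is what makes fibres closed.\<close>

lemma image_decreasing_INT_closedin:
  fixes C :: "'i::linorder \<Rightarrow> 'a set"
  assumes X: "compact_space X" and Y: "t1_space Y" and f: "continuous_map X Y f"
    and I: "I \<noteq> {}" and C: "\<And>i. i \<in> I \<Longrightarrow> closedin X (C i)"
    and dec: "\<And>i j. i \<in> I \<Longrightarrow> j \<in> I \<Longrightarrow> i \<le> j \<Longrightarrow> C j \<subseteq> C i"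
  shows "f ` (\<Inter>i\<in>I. C i) = (\<Inter>i\<in>I. f ` C i)"
proof
  show "(\<Inter>i\<in>I. f ` C i) \<subseteq> f ` (\<Inter>i\<in>I. C i)"
  proof
    fix y
    assume y: "y \<in> (\<Inter>i\<in>I. f ` C i)"
    define F where "F i = {x \<in> C i. f x = y}" for i
    have Fne: "F i \<noteq> {}" if "i \<in> I" for i
      using y that unfolding F_def by auto
    obtain i x where "i \<in> I" "x \<in> C i" "y = f x"
      using y I by blast
    then have "y \<in> topspace Y"
      using closedin_subset[OF C] continuous_map_image_subset_topspace[OF f] by blast
    then have "closedin Y {y}"
      using Y by (simp add: t1_space_closedin_singleton)
    with f have "closedin X {x \<in> topspace X. f x \<in> {y}}"
      by (rule closedin_continuous_map_preimage)
    moreover have "F i = C i \<inter> {x \<in> topspace X. f x \<in> {y}}" if "i \<in> I" for i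
      using closedin_subset[OF C[OF that]] unfolding F_def by auto
    ultimately have "closedin X (F i)" if "i \<in> I" for i
      using C that by (simp add: closedin_Int)
    moreover have "\<Inter>\<F> \<noteq> {}" if \<F>: "finite \<F>" "\<F> \<subseteq> F ` I" for \<F>
    proof -
      obtain J where J: "J \<subseteq> I" "finite J" "\<F> = F ` J"
        using finite_subset_image[OF \<F>] by blast
      show ?thesis
      proof (cases "J = {}")
        case False
        \<comment> \<open>the family decreases, so its member at the largest index lies in all the others\<close>
        then have max: "Max J \<in> I"
          using J Max_in[of J] by blast
        have "C (Max J) \<subseteq> C j" if "j \<in> J" for j
          using that J max by (intro dec) auto
        then have "F (Max J) \<subseteq> \<Inter>\<F>"
          unfolding J(3) F_def by blast
        then show ?thesis
          using Fne[OF max] by blast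
      qed (simp add: J)
    qed
    ultimately have "(\<Inter>i\<in>I. F i) \<noteq> {}"
      by (intro X[unfolded compact_space_fip, rule_format, of "F ` I"]) auto
    then show "y \<in> f ` (\<Inter>i\<in>I. C i)"
      using I unfolding F_def by blast
  qed
qed blast

section \<open>Open semiconjugacies\<close>

locale open_semiconjugacy =
  fixes T :: "real set" and Z :: "'z::metric_space set" and W :: "'w::metric_space set"
    and \<theta> :: "real \<Rightarrow> 'z \<Rightarrow> 'z" and \<psi> :: "real \<Rightarrow> 'w \<Rightarrow> 'w" and h :: "'z \<Rightarrow> 'w"
  assumes zero_in_time: "0 \<in> T"
    and compact_domain: "compact Z"
    and cont: "continuous_map (top_of_set Z) (top_of_set W) h"
    and opn: "open_map (top_of_set Z) (top_of_set W) h"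
    and invariant: "t \<in> T \<Longrightarrow> 0 \<le> t \<Longrightarrow> z \<in> Z \<Longrightarrow> \<theta> t z \<in> Z"
    and intertwines: "t \<in> T \<Longrightarrow> 0 \<le> t \<Longrightarrow> z \<in> Z \<Longrightarrow> h (\<theta> t z) = \<psi> t (h z)"
begin

lemma image_closure_of:
  assumes "S \<subseteq> Z"
  shows "h ` (top_of_set Z closure_of S) = top_of_set W closure_of (h ` S)"
proof (rule closed_map_image_closure_of[OF cont])
  show "closed_map (top_of_set Z) (top_of_set W) h"
  proof (rule continuous_imp_closed_map_gen[OF _ _ cont])
    show "compact_space (top_of_set Z)"
      using compact_domain by (simp add: compact_space_subtopology)
    show "kc_space (top_of_set W)"
      by (intro Hausdorff_imp_kc_space Hausdorff_space_subtopology) simp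
  qed
qed (use assms in simp)

lemma attracting_nbhd_image:
  assumes "attracting_nbhd T Z \<theta> N"
  shows "attracting_nbhd T W \<psi> (h ` N)"
proof -
  let ?clZ = "\<lambda>S. top_of_set Z closure_of S" and ?clW = "\<lambda>S. top_of_set W closure_of S"
  let ?intZ = "\<lambda>S. top_of_set Z interior_of S" and ?intW = "\<lambda>S. top_of_set W interior_of S"
  obtain \<tau> where N: "N \<subseteq> Z" and \<tau>: "\<tau> \<in> T" "0 < \<tau>"
    and attr: "\<And>t. t \<in> T \<Longrightarrow> \<tau> \<le> t \<Longrightarrow> \<theta> t ` ?clZ N \<subseteq> ?intZ N"
    using assms unfolding attracting_nbhd_def by blast
  have "\<psi> t ` ?clW (h ` N) \<subseteq> ?intW (h ` N)" if t: "t \<in> T" "\<tau> \<le> t" for t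
  proof -
    have "?clZ N \<subseteq> Z"
      using closure_of_subset_topspace[of "top_of_set Z" N] by simp
    then have "\<psi> t ` h ` ?clZ N = h ` \<theta> t ` ?clZ N"
      using t \<tau> intertwines[of t] by (force simp: image_image)
    also have "\<dots> \<subseteq> h ` ?intZ N"
      using attr[OF t] by (rule image_mono)
    also have "\<dots> \<subseteq> ?intW (h ` N)"
      using opn by (simp add: open_map_interior_of_image_subset)
    finally show ?thesis
      by (simp add: image_closure_of[OF N])
  qed
  moreover have "h ` N \<subseteq> W"
    using N continuous_map_image_subset_topspace[OF cont] by auto
  ultimately show ?thesis
    using \<tau> unfolding attracting_nbhd_def by (intro conjI bexI[of _ \<tau>]) simp_all
qed

lemma orbit_tail_image:
  assumes "N \<subseteq> Z" "0 \<le> t"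
  shows "h ` orbit_tail T \<theta> t N = orbit_tail T \<psi> t (h ` N)"
proof
  show "h ` orbit_tail T \<theta> t N \<subseteq> orbit_tail T \<psi> t (h ` N)"
    using assms intertwines unfolding orbit_tail_def
    by clarsimp (metis image_eqI order_trans subsetD)
  show "orbit_tail T \<psi> t (h ` N) \<subseteq> h ` orbit_tail T \<theta> t N"
  proof
    fix w assume "w \<in> orbit_tail T \<psi> t (h ` N)"
    then obtain s z where "s \<in> T" "t \<le> s" "z \<in> N" "w = \<psi> s (h z)"
      unfolding orbit_tail_def by blast
    then have "w = h (\<theta> s z)" "\<theta> s z \<in> orbit_tail T \<theta> t N"
      using assms intertwines[of s z] unfolding orbit_tail_def by auto
    then show "w \<in> h ` orbit_tail T \<theta> t N" by blast
  qed
qed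

lemma omega_limit_image:
  assumes "N \<subseteq> Z"
  shows "h ` omega_limit T Z \<theta> N = omega_limit T W \<psi> (h ` N)"
proof -
  let ?K = "\<lambda>t. top_of_set Z closure_of orbit_tail T \<theta> t N"
  have "h ` omega_limit T Z \<theta> N = (\<Inter>t\<in>nonneg_time T. h ` ?K t)"
    unfolding omega_limit_eq_INT_orbit_tail
  proof (rule image_decreasing_INT_closedin[OF _ _ cont])
    show "compact_space (top_of_set Z)"
      using compact_domain by (simp add: compact_space_subtopology)
    show "t1_space (top_of_set W)"
      by (intro Hausdorff_imp_t1_space Hausdorff_space_subtopology) simp
    show "nonneg_time T \<noteq> {}"
      using zero_in_time unfolding nonneg_time_def by blast
    show "?K t \<subseteq> ?K s" if "s \<le> t" for s t
      using that by (intro closure_of_mono orbit_tail_antimono)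
  qed simp
  also have "\<dots> = (\<Inter>t\<in>nonneg_time T. top_of_set W closure_of orbit_tail T \<psi> t (h ` N))"
  proof (rule INF_cong[OF refl])
    fix t assume "t \<in> nonneg_time T"
    then have t: "0 \<le> t" by (simp add: nonneg_time_def)
    then have "orbit_tail T \<theta> t N \<subseteq> Z"
      using assms invariant unfolding orbit_tail_def by fastforce
    then show "h ` ?K t = top_of_set W closure_of orbit_tail T \<psi> t (h ` N)"
      by (simp add: image_closure_of orbit_tail_image[OF assms t])
  qed
  finally show ?thesis
    by (simp add: omega_limit_eq_INT_orbit_tail)
qed

lemma join_semilattice_hom_ANbhd:
  "join_semilattice_hom (ANbhd T Z \<theta>) (\<union>) (ANbhd T W \<psi>) (\<union>) (\<lambda>N. h ` N)"
proof -
  have "h ` N \<in> ANbhd T W \<psi>" if "N \<in> ANbhd T Z \<theta>" for N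
    using that by (simp add: ANbhd_def attracting_nbhd_image)
  then show ?thesis
    unfolding join_semilattice_hom_def by (simp add: join_semilattice_ANbhd image_Un)
qed

lemma omega_limit_image_ANbhd:
  "N \<in> ANbhd T Z \<theta> \<Longrightarrow> h ` omega_limit T Z \<theta> N = omega_limit T W \<psi> (h ` N)"
  by (rule omega_limit_image) (simp add: ANbhd_def attracting_nbhd_def)

lemma join_semilattice_hom_Att:
  "join_semilattice_hom (Att T Z \<theta>) (\<union>) (Att T W \<psi>) (\<union>) (\<lambda>A. h ` A)"
proof -
  have "h ` A \<in> Att T W \<psi>" if "A \<in> Att T Z \<theta>" for A
    using that attracting_nbhd_image omega_limit_image_ANbhd unfolding Att_def ANbhd_def by auto
  then show ?thesis
    unfolding join_semilattice_hom_def by (simp add: join_semilattice_Att image_Un)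
qed

end

section \<open>The projection of a product or skew product\<close>

lemma open_semiconjugacy_snd:
  fixes X :: "'x::metric_space set" and Y :: "'y::metric_space set"
  assumes "product_system T X Y \<psi> \<Theta> \<or> skew_product_system T X Y \<psi> \<Theta>"
  shows "open_semiconjugacy T (X \<times> Y) Y \<Theta> \<psi> snd"
proof
  have top: "top_of_set (X \<times> Y) = prod_topology (top_of_set X) (top_of_set Y)"
    by (simp add: subtopology_Times)
  show "continuous_map (top_of_set (X \<times> Y)) (top_of_set Y) snd"
    "open_map (top_of_set (X \<times> Y)) (top_of_set Y) snd"
    unfolding top by (rule continuous_map_snd open_map_snd)+
  show "0 \<in> T" "compact (X \<times> Y)"
    using assms unfolding product_system_def skew_product_system_def dynamical_system_def
    by (auto intro: compact_Times)
  fix t z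
  assume "t \<in> T" "0 \<le> t" and z: "z \<in> X \<times> Y"
  then have t: "t \<in> nonneg_time T" by (simp add: nonneg_time_def)
  show "\<Theta> t z \<in> X \<times> Y" "snd (\<Theta> t z) = \<psi> t (snd z)"
    using assms t z
    by (auto simp: product_system_def skew_product_system_def dynamical_system_def
        fibre_cocycle_def product_map_def skew_product_map_def)
qed

theorem proposition3p5:
  fixes T :: "real set"
    and X :: "'x::metric_space set" and Y :: "'y::metric_space set"
    and \<psi> :: "real \<Rightarrow> 'y \<Rightarrow> 'y" and \<Theta> :: "real \<Rightarrow> 'x \<times> 'y \<Rightarrow> 'x \<times> 'y"
  assumes "product_system T X Y \<psi> \<Theta> \<or> skew_product_system T X Y \<psi> \<Theta>"
  shows "join_semilattice_hom (ANbhd T (X \<times> Y) \<Theta>) (\<union>) (ANbhd T Y \<psi>) (\<union>) (\<lambda>N. snd ` N) \<and>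
    (\<forall>N \<in> ANbhd T (X \<times> Y) \<Theta>.
       snd ` omega_limit T (X \<times> Y) \<Theta> N = omega_limit T Y \<psi> (snd ` N)) \<and>
    join_semilattice_hom (Att T (X \<times> Y) \<Theta>) (\<union>) (Att T Y \<psi>) (\<union>) (\<lambda>A. snd ` A)"
proof -
  interpret open_semiconjugacy T "X \<times> Y" Y \<Theta> \<psi> snd
    using assms by (rule open_semiconjugacy_snd)
  show ?thesis
    using join_semilattice_hom_ANbhd omega_limit_image_ANbhd join_semilattice_hom_Att by blast
qed

end
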